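(* Let $D=\mathbb{R}^n$ or $D=\mathbb{R}_+^n=(0,\infty)^n$, and let $(X_1,\dots,X_n)$ be a random vector with values in $D$ whose cumulative distribution function $F(x_1,\dots,x_n)=P(X_1\le x_1,\dots,X_n\le x_n)$ satisfies $F\in C^2(D)$, is MTP$_2$ on $D$, and has a probability density $f$ that is everywhere positive on $D$. Then for all $\vec{x}=(x_1,\dots,x_n)\in D$ and $\vec{b}=(b_1,\dots,b_n)\in D$ with $x_i\le b_i$ for $i=1,\dots,n$, and every nonempty proper subset $I\subset\{1,\dots,n\}$, with $A_i=\{X_i\le x_i\}$ and $B_i=\{X_i\le b_i\}$, $$\frac{P\left(\bigcap_{i=1}^n A_i\right)}{P\left(\bigcap_{i\in I}A_i\right)P\left(\bigcap_{i\notin I}A_i\right)}\ \ge\ \frac{P\left(\bigcap_{i=1}^n B_i\right)}{P\left(\bigcap_{i\in I}B_i\right)P\left(\bigcap_{i\notin I}B_i\right)}.$$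
   Context: For $\vec{x},\vec{y}\in\mathbb{R}^n$ let $\vec{x}\vee\vec{y}$ and $\vec{x}\wedge\vec{y}$ denote the componentwise maximum and minimum. A function $F$ that is everywhere positive on $D=D_1\times\dots\times D_n$ (a product of intervals) is called MTP$_2$ (multivariate totally positive of order 2) on $D$ if $F(\vec{x}\vee\vec{y})F(\vec{x}\wedge\vec{y})\ge F(\vec{x})F(\vec{y})$ for all $\vec{x},\vec{y}\in D$. *)

theory Defs
  imports "HOL-Probability.Probability"
begin

text \<open>
  Random vectors take values in \<^typ>\<open>real ^ 'n\<close>; on this type \<^const>\<open>sup\<close>, \<^const>\<open>inf\<close> are the
  componentwise maximum and minimum.
\<close>

definition pos_orthant :: "(real ^ 'n) set"
  where "pos_orthant = {x. \<forall>i. 0 < x $ i}"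

definition le_event :: "'a measure \<Rightarrow> ('a \<Rightarrow> real ^ 'n) \<Rightarrow> real ^ 'n \<Rightarrow> 'n \<Rightarrow> 'a set"
  where "le_event M X x i = {\<omega> \<in> space M. X \<omega> $ i \<le> x $ i}"

definition joint_cdf :: "'a measure \<Rightarrow> ('a \<Rightarrow> real ^ 'n) \<Rightarrow> real ^ 'n \<Rightarrow> real"
  where "joint_cdf M X x = measure M {\<omega> \<in> space M. \<forall>i. X \<omega> $ i \<le> x $ i}"

text \<open>
  \<open>C2_on F D\<close>, for open \<open>D\<close>: \<open>F\<close> is continuous on \<open>D\<close>, and all its partial derivatives of order
  one (\<open>G i\<close>) and two (\<open>H i j\<close>) exist and are continuous on \<open>D\<close>.
\<close>

definition C2_on :: "(real ^ 'n \<Rightarrow> real) \<Rightarrow> (real ^ 'n) set \<Rightarrow> bool"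
  where "C2_on F D \<longleftrightarrow>
    continuous_on D F \<and>
    (\<exists>G H.
      (\<forall>i. continuous_on D (G i) \<and>
        (\<forall>x\<in>D. ((\<lambda>t. F (x + t *\<^sub>R axis i 1)) has_real_derivative G i x) (at 0))) \<and>
      (\<forall>i j. continuous_on D (H i j) \<and>
        (\<forall>x\<in>D. ((\<lambda>t. G i (x + t *\<^sub>R axis j 1)) has_real_derivative H i j x) (at 0))))"

text \<open>Positivity on \<open>D\<close> is part of the notion.\<close>

definition MTP2_on :: "(real ^ 'n \<Rightarrow> real) \<Rightarrow> (real ^ 'n) set \<Rightarrow> bool"
  where "MTP2_on F D \<longleftrightarrow>
    (\<forall>x\<in>D. 0 < F x) \<and>
    (\<forall>x\<in>D. \<forall>y\<in>D. F (sup x y) * F (inf x y) \<ge> F x * F y)"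

end

theory Submission
  imports Defs
begin

text \<open>
  The claim follows from the lattice inequality for the distribution function \<open>F\<close>. Suppose that \<open>u \<le> v\<close> differ
  only in the coordinates of \<open>I\<close>, and let \<open>u'\<close>, \<open>v'\<close> arise from them by raising the coordinates
  outside \<open>I\<close> by a common amount. Then \<open>sup v u' = v'\<close> and \<open>inf v u' = u\<close>, so that
  \<open>F v' * F u \<ge> F v * F u'\<close>. If the amount tends to infinity, \<open>F u'\<close> and \<open>F v'\<close> tend to the marginal
  distribution function \<open>F\<^sub>I\<close> at \<open>u\<close> and \<open>v\<close> (\<open>joint_cdf_tendsto_marginal\<close>), and therefore
  \<open>F u * F\<^sub>I v \<ge> F v * F\<^sub>I u\<close>: the ratio \<open>F / F\<^sub>I\<close> decreases in the coordinates of \<open>I\<close>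
  (\<open>cdf_marginal_ratio_antimono\<close>).

  A path from \<open>x\<close> to \<open>b\<close> that first raises the coordinates in \<open>I\<close> and then those in \<open>-I\<close> gives
  the theorem: along the first part \<open>F\<^sub>-\<^sub>I\<close> stays constant and \<open>F / F\<^sub>I\<close> decreases, and along the second
  part the roles of \<open>I\<close> and \<open>-I\<close> are exchanged.
\<close>

lemma le_event_measurable:
  fixes X :: "'a \<Rightarrow> real ^ 'n"
  assumes "X \<in> borel_measurable M"
  shows "le_event M X x i \<in> sets M"
proof -
  have "(\<lambda>\<omega>. X \<omega> $ i) \<in> borel_measurable M"
    using assms by (rule borel_measurable_continuous_on[rotated]) (intro continuous_intros)
  then show ?thesis
    unfolding le_event_def by measurable
qed

lemma joint_cdf_eq_Inter: "joint_cdf M X x = measure M (\<Inter>i. le_event M X x i)"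
  unfolding joint_cdf_def le_event_def by (rule arg_cong[where f = "measure M"]) auto

definition raise_outside :: "'n set \<Rightarrow> real \<Rightarrow> real ^ 'n \<Rightarrow> real ^ 'n"
  where "raise_outside I t x = (\<chi> i. if i \<in> I then x $ i else x $ i + t)"

text \<open>
  For \<open>I = {}\<close> the intersection would be the whole type instead of the space of \<open>M\<close>, whence the
  hypothesis on \<open>I\<close>.
\<close>

lemma joint_cdf_tendsto_marginal:
  fixes X :: "'a \<Rightarrow> real ^ 'n"
  assumes "finite_measure M" "X \<in> borel_measurable M" "I \<noteq> {}"
  shows "(\<lambda>k. joint_cdf M X (raise_outside I (real k) x))
    \<longlonglongrightarrow> measure M (\<Inter>i\<in>I. le_event M X x i)"
proof -
  interpret finite_measure M by fact
  define E where "E k = (\<Inter>i. le_event M X (raise_outside I (real k) x) i)" for k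
  have "range E \<subseteq> sets M"
    using le_event_measurable[OF assms(2)] unfolding E_def by (auto intro!: sets.finite_INT)
  moreover have "incseq E"
  proof (rule incseq_SucI)
    show "E k \<le> E (Suc k)" for k
      unfolding E_def le_event_def raise_outside_def by (fastforce split: if_splits)
  qed
  ultimately have "(\<lambda>k. measure M (E k)) \<longlonglongrightarrow> measure M (\<Union>k. E k)"
    by (rule finite_Lim_measure_incseq)
  moreover have "(\<Union>k. E k) = (\<Inter>i\<in>I. le_event M X x i)"
  proof (intro equalityI subsetI)
    fix \<omega> assume "\<omega> \<in> (\<Union>k. E k)"
    then show "\<omega> \<in> (\<Inter>i\<in>I. le_event M X x i)"
      unfolding E_def le_event_def raise_outside_def by (auto split: if_splits)
  next
    fix \<omega> assume \<omega>: "\<omega> \<in> (\<Inter>i\<in>I. le_event M X x i)"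
    obtain k where k: "(MAX i. X \<omega> $ i - x $ i) \<le> real k"
      using real_arch_simple by blast
    have "X \<omega> $ i - x $ i \<le> real k" for i
      using k by (rule order_trans[rotated]) (intro Max_ge; simp)
    then have "X \<omega> $ i \<le> x $ i + real k" for i
      by (simp add: algebra_simps)
    then have "\<omega> \<in> E k"
      using \<omega> \<open>I \<noteq> {}\<close> unfolding E_def le_event_def raise_outside_def by auto
    then show "\<omega> \<in> (\<Union>k. E k)" by blast
  qed
  ultimately show ?thesis
    by (simp only: joint_cdf_eq_Inter E_def)
qed

text \<open>
  In division-free form: \<open>F / F\<^sub>I\<close> decreases when coordinates in \<open>I\<close> grow. The upward closure of
  \<open>D\<close> is what allows the remaining coordinates to be sent to infinity inside \<open>D\<close>.
\<close>

lemma cdf_marginal_ratio_antimono: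
  fixes X :: "'a \<Rightarrow> real ^ 'n"
  assumes "finite_measure M" "X \<in> borel_measurable M" "I \<noteq> {}"
    and mtp: "MTP2_on (joint_cdf M X) D"
    and D_up: "\<And>y z. y \<in> D \<Longrightarrow> (\<And>i. y $ i \<le> z $ i) \<Longrightarrow> z \<in> D"
    and "u \<in> D" "v \<in> D" and le: "\<And>i. u $ i \<le> v $ i" and eq: "\<And>i. i \<notin> I \<Longrightarrow> u $ i = v $ i"
  shows "joint_cdf M X v * measure M (\<Inter>i\<in>I. le_event M X u i)
    \<le> joint_cdf M X u * measure M (\<Inter>i\<in>I. le_event M X v i)"
proof -
  let ?F = "joint_cdf M X"
  let ?u = "\<lambda>k. raise_outside I (real k) u" and ?v = "\<lambda>k. raise_outside I (real k) v"
  have "?F v * ?F (?u k) \<le> ?F u * ?F (?v k)" for k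
  proof -
    have "?u k \<in> D"
      using \<open>u \<in> D\<close> by (rule D_up) (simp add: raise_outside_def)
    then have "?F v * ?F (?u k) \<le> ?F (sup v (?u k)) * ?F (inf v (?u k))"
      using mtp \<open>v \<in> D\<close> unfolding MTP2_on_def by blast
    also have "sup v (?u k) = ?v k"
      using le eq by (auto simp: vec_eq_iff sup_vec_def raise_outside_def sup_real_def)
    also have "inf v (?u k) = u"
      using le eq by (auto simp: vec_eq_iff inf_vec_def raise_outside_def inf_real_def inf_absorb2)
    finally show ?thesis by (simp add: mult.commute)
  qed
  then show ?thesis
    using joint_cdf_tendsto_marginal[OF assms(1-3)]
    by (intro LIMSEQ_le[of "\<lambda>k. ?F v * ?F (?u k)" _ "\<lambda>k. ?F u * ?F (?v k)"] tendsto_mult_left) auto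
qed

theorem theorem1:
  fixes M :: "'a measure"
    and X :: "'a \<Rightarrow> real ^ 'n"
    and f :: "real ^ 'n \<Rightarrow> real"
    and D :: "(real ^ 'n) set"
    and x b :: "real ^ 'n"
    and I :: "'n set"
  assumes "prob_space M"
    and "D = UNIV \<or> D = pos_orthant"
    and "X \<in> borel_measurable M"
    and "\<And>\<omega>. \<omega> \<in> space M \<Longrightarrow> X \<omega> \<in> D"
    and "C2_on (joint_cdf M X) D"
    and "MTP2_on (joint_cdf M X) D"
    and "\<And>z. 0 \<le> f z"
    and "distributed M lborel X (\<lambda>z. ennreal (f z))"
    and "\<And>z. z \<in> D \<Longrightarrow> 0 < f z"
    and "x \<in> D" and "b \<in> D" and "\<And>i. x $ i \<le> b $ i"
    and "I \<noteq> {}" and "I \<noteq> UNIV"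
  shows "measure M (\<Inter>i. le_event M X x i) /
      (measure M (\<Inter>i\<in>I. le_event M X x i) * measure M (\<Inter>i\<in>-I. le_event M X x i))
    \<ge> measure M (\<Inter>i. le_event M X b i) /
      (measure M (\<Inter>i\<in>I. le_event M X b i) * measure M (\<Inter>i\<in>-I. le_event M X b i))"
proof -
  interpret prob_space M by fact
  let ?F = "joint_cdf M X" and ?m = "\<lambda>J y. measure M (\<Inter>i\<in>J. le_event M X y i)"
  have fin: "finite_measure M" by unfold_locales
  have D_up: "z \<in> D" if "y \<in> D" "\<And>i. y $ i \<le> z $ i" for y z
    using assms(2) that by (auto simp: pos_orthant_def intro: less_le_trans)
  have ratio: "?F v * ?m J u \<le> ?F u * ?m J v"
    if "J \<noteq> {}" "u \<in> D" "v \<in> D" "\<And>i. u $ i \<le> v $ i" "\<And>i. i \<notin> J \<Longrightarrow> u $ i = v $ i" for J u v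
    by (rule cdf_marginal_ratio_antimono[where D = D]) (fact fin assms(3,6) D_up that)+
  have "- I \<noteq> {}" using \<open>I \<noteq> UNIV\<close> by auto

  \<comment> \<open>The corner of the path from \<open>x\<close> to \<open>b\<close>: it agrees with \<open>b\<close> on \<open>I\<close> and with \<open>x\<close> elsewhere.\<close>
  define c where "c = (\<chi> i. if i \<in> I then b $ i else x $ i)"
  have "c \<in> D"
    using \<open>x \<in> D\<close> by (rule D_up) (simp add: c_def assms(12))
  have m_c: "?m I c = ?m I b" "?m (- I) c = ?m (- I) x"
    by (simp_all add: c_def le_event_def)
  have I_step: "?F c * ?m I x \<le> ?F x * ?m I b"
    using ratio[OF \<open>I \<noteq> {}\<close> \<open>x \<in> D\<close> \<open>c \<in> D\<close>] assms(12) unfolding m_c by (simp add: c_def)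
  have compl_step: "?F b * ?m (- I) x \<le> ?F c * ?m (- I) b"
    using ratio[OF \<open>- I \<noteq> {}\<close> \<open>c \<in> D\<close> \<open>b \<in> D\<close>] assms(12) unfolding m_c by (simp add: c_def)

  have F_pos: "0 < ?F y" if "y \<in> D" for y
    using assms(6) that unfolding MTP2_on_def by blast
  have m_pos: "0 < ?m J y" if "y \<in> D" "J \<noteq> {}" for y J
  proof -
    have "?F y \<le> ?m J y"
      unfolding joint_cdf_eq_Inter using le_event_measurable[OF assms(3)] \<open>J \<noteq> {}\<close>
      by (intro finite_measure_mono) (auto intro!: sets.finite_INT)
    then show ?thesis using F_pos[OF \<open>y \<in> D\<close>] by linarith
  qed
  have x_pos: "0 < ?m I x * ?m (- I) x" and b_pos: "0 < ?m I b * ?m (- I) b"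
    by (intro mult_pos_pos m_pos \<open>x \<in> D\<close> \<open>b \<in> D\<close> \<open>I \<noteq> {}\<close> \<open>- I \<noteq> {}\<close>)+

  have "?F c * (?F b * (?m I x * ?m (- I) x)) = (?F c * ?m I x) * (?F b * ?m (- I) x)"
    by (simp add: mult_ac)
  also have "\<dots> \<le> (?F x * ?m I b) * (?F c * ?m (- I) b)"
    by (intro mult_mono[OF I_step compl_step] mult_nonneg_nonneg measure_nonneg
        less_imp_le[OF F_pos] \<open>x \<in> D\<close> \<open>b \<in> D\<close>)
  also have "\<dots> = ?F c * (?F x * (?m I b * ?m (- I) b))"
    by (simp add: mult_ac)
  finally have "?F b * (?m I x * ?m (- I) x) \<le> ?F x * (?m I b * ?m (- I) b)"
    using F_pos[OF \<open>c \<in> D\<close>] by simp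
  then show ?thesis
    by (simp only: joint_cdf_eq_Inter[symmetric] pos_divide_le_eq[OF b_pos]
        times_divide_eq_left pos_le_divide_eq[OF x_pos])
qed

end
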